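(* Let $d\ge 1$ be an integer, let $\alpha>d$ and $\lambda>0$, and let $(W_x)_{x\in\mathbb{Z}^d}$ be i.i.d. non-negative random variables, distributed as $W$. Assume that there exist $\tau>1$ and $c>0$ such that $$\mathbb{P}(W>w)\le c\,w^{-(\tau-1)}\quad\text{for all } w>0,$$ and that $\gamma:=\alpha(\tau-1)/d>2$. Then, for the random graph with edge probabilities $p_{xy}=1-\exp\{-\lambda W_xW_y/|x-y|^{\alpha}\}$, there exists $\eta>0$ such that $$\lim_{|x|\to\infty}\mathbb{P}\big(d(0,x)\ge \eta\log|x|\big)=1.$$
   Context: The random graph has vertex set $\mathbb{Z}^d$; conditionally on the weights $(W_x)_{x\in\mathbb{Z}^d}$, the edges between distinct vertices $x,y$ are independently present (occupied) with probability $p_{xy}=1-\exp\{-\lambda W_xW_y/|x-y|^{\alpha}\}$, where $|\cdot|$ is the Euclidean norm. The graph distance $d(0,x)$ is the minimum number of occupied edges forming a path from $0$ to $x$, with $d(0,x)=\infty$ if $0$ and $x$ are not connected (the integer $d$ without arguments is the dimension). The limit is over $x\in\mathbb{Z}^d$ with $|x|\to\infty$. Standing normalization: if the weights have finite mean, they are normalized so that $\mathbb{E}[W]=1$ (for non-degenerate weights this amounts only to rescaling $\lambda$). *)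

theory Defs
  imports "HOL-Probability.Probability"
begin

definition euclid_norm :: "int ^ 'd \<Rightarrow> real" where
  "euclid_norm x = norm ((\<chi> i. real_of_int (x $ i)) :: real ^ 'd)"

text \<open>A simple graph is given by its set of edges, an edge being a two-element set of vertices.\<close>

definition complete_edges :: "'v set set" where
  "complete_edges = {{x, y} |x y. x \<noteq> y}"

definition graph_paths :: "'v set set \<Rightarrow> 'v \<Rightarrow> 'v \<Rightarrow> 'v list set" where
  "graph_paths E x y =
     {vs. vs \<noteq> [] \<and> hd vs = x \<and> last vs = y \<and> distinct vs \<and> successively (\<lambda>u v. {u, v} \<in> E) vs}"

text \<open>A path with vertex list \<open>vs\<close> has \<open>length vs - 1\<close> edges. The infimum over the empty
  set is \<open>\<infinity>\<close>, so vertices that are not connected are at infinite distance.\<close>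

definition graph_dist :: "'v set set \<Rightarrow> 'v \<Rightarrow> 'v \<Rightarrow> enat" where
  "graph_dist E x y = (INF vs\<in>graph_paths E x y. enat (length vs - 1))"

definition cond_prob_given :: "'a measure \<Rightarrow> 'a measure \<Rightarrow> 'a set \<Rightarrow> 'a \<Rightarrow> real" where
  "cond_prob_given M F A = real_cond_exp M F (indicator A)"

definition cond_indep_events :: "'a measure \<Rightarrow> 'a measure \<Rightarrow> ('i \<Rightarrow> 'a set) \<Rightarrow> 'i set \<Rightarrow> bool" where
  "cond_indep_events M F A I \<longleftrightarrow>
     A ` I \<subseteq> sets M \<and>
     (\<forall>J\<subseteq>I. J \<noteq> {} \<longrightarrow> finite J \<longrightarrow>
        (AE \<omega> in M. cond_prob_given M F (\<Inter>j\<in>J. A j) \<omega> = (\<Prod>j\<in>J. cond_prob_given M F (A j) \<omega>)))"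

definition weight_algebra :: "'a measure \<Rightarrow> ('v \<Rightarrow> 'a \<Rightarrow> real) \<Rightarrow> 'a measure" where
  "weight_algebra M W = vimage_algebra (space M) (\<lambda>\<omega> x. W x \<omega>) (\<Pi>\<^sub>M x\<in>UNIV. borel)"

text \<open>An arbitrary realisation of the model on a probability space \<open>M\<close>: \<open>\<mu>\<close> is the common law of
  the weights, and \<open>occ e\<close> is the event that the edge \<open>e\<close> is occupied.\<close>

locale scale_free_percolation = prob_space M
  for M :: "'a measure" +
  fixes \<mu> :: "real measure"
    and W :: "int ^ 'd \<Rightarrow> 'a \<Rightarrow> real"
    and occ :: "(int ^ 'd) set \<Rightarrow> 'a set"
    and alpha lam :: real
  assumes weights_indep: "indep_vars (\<lambda>_. borel) W UNIV"
    and weights_law: "\<And>x. distr M borel (W x) = \<mu>"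
    and weights_nonneg: "\<And>x. AE \<omega> in M. 0 \<le> W x \<omega>"
    and edges_cond_indep: "cond_indep_events M (weight_algebra M W) occ complete_edges"
    and edges_cond_prob: "\<And>x y. x \<noteq> y \<Longrightarrow>
      AE \<omega> in M. cond_prob_given M (weight_algebra M W) (occ {x, y}) \<omega> =
        1 - exp (- (lam * W x \<omega> * W y \<omega> / euclid_norm (x - y) powr alpha))"

definition occupied_edges :: "('v set \<Rightarrow> 'a set) \<Rightarrow> 'a \<Rightarrow> 'v set set" where
  "occupied_edges occ \<omega> = {e \<in> complete_edges. \<omega> \<in> occ e}"

end

theory Submission
  imports Defs
begin

text \<open>The proof is a first moment count of self-avoiding paths: if the expected number of occupied
  paths with \<open>n\<close> edges from \<open>0\<close> to \<open>x\<close> is at most \<open>A ^ (n + 1) * norm x powr - \<beta>\<close> for some \<open>\<beta> > 0\<close>,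
  then paths with fewer than \<open>\<eta> * ln (norm x)\<close> edges contribute a negative power of \<open>norm x\<close>, as
  soon as \<open>\<eta> * ln A < \<beta>\<close>.

  The obstacle is that consecutive edges of a path share a vertex weight, so that their occupation
  is correlated. This is resolved by interpolation. Since \<open>1 - exp (- u) \<le> u powr t\<close> for
  \<open>0 < t \<le> 1\<close>, the conditional probability that the edge \<open>xy\<close> is occupied is at most a constant times
  \<open>norm (x - y) powr - (alpha * t)\<close> times \<open>(W\<^sub>x * W\<^sub>y) powr t\<close>. Along a self-avoiding path every vertex
  lies on at most two edges, so the product of the weight factors is bounded by a product of powers
  \<open>max 1 W\<^sub>x powr (2 * t)\<close> over distinct vertices, and independence turns its expectation into a power
  of a single moment. That moment is finite if \<open>2 * t < tau - 1\<close>, while the spatial factors are summable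
  over the lattice if \<open>alpha * t > d\<close>. Together with \<open>t \<le> 1\<close> this leaves the window
  \<open>d / alpha < t < min 1 ((tau - 1) / 2)\<close>, which is nonempty because \<open>alpha > d\<close> and
  \<open>alpha * (tau - 1) / d > 2\<close>.

  It remains to sum over all paths. For \<open>\<beta> = alpha * t > d\<close> the convolution of
  \<open>norm x powr - \<beta>\<close> with itself is again at most a constant times \<open>norm x powr - \<beta>\<close>
  (\<open>decay_convolution\<close>): one of two steps with total displacement \<open>x\<close> has length at least
  \<open>norm x / 2\<close>, and the other one is summed freely. Iterating this (\<open>sum_path_weight_le\<close>) gives the
  exponential bound in the number of edges with the spatial decay preserved (\<open>prob_reach_le\<close>).\<close>

section \<open>Weights of paths\<close>

fun path_weight :: "('v \<Rightarrow> 'v \<Rightarrow> 'b::comm_monoid_mult) \<Rightarrow> 'v list \<Rightarrow> 'b" where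
  "path_weight g (u # v # vs) = g u v * path_weight g (v # vs)"
| "path_weight g vs = 1"

lemma path_weight_nonneg:
  fixes g :: "'v \<Rightarrow> 'v \<Rightarrow> 'b::linordered_semidom"
  assumes "\<And>u v. 0 \<le> g u v"
  shows "0 \<le> path_weight g vs"
  using assms by (induction g vs rule: path_weight.induct) auto

lemma path_weight_times:
  "path_weight (\<lambda>u v. g u v * h u v) vs = path_weight g vs * path_weight h vs"
  by (induction g vs rule: path_weight.induct) (auto simp: ac_simps)

text \<open>A transfer-operator bound: the total weight of the paths with \<open>n\<close> edges from \<open>u\<close> to \<open>v\<close> is an
  entry of the \<open>n\<close>-th power of the kernel \<open>g\<close>, and a majorant \<open>h\<close> of the identity that one
  application of \<open>g\<close> enlarges by a factor of at most \<open>K\<close> is enlarged by at most \<open>K ^ n\<close> after \<open>n\<close>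
  applications. Restricting all sums to finite sets avoids any question of summability.\<close>

lemma sum_path_weight_le:
  fixes g h :: "'v \<Rightarrow> 'v \<Rightarrow> real"
  assumes g: "\<And>u v. 0 \<le> g u v" and h: "\<And>u v. 0 \<le> h u v" and diag: "\<And>v. 1 \<le> h v v"
    and step: "\<And>Z u v. finite Z \<Longrightarrow> (\<Sum>z\<in>Z. g u z * h z v) \<le> K * h u v"
    and "finite S" "\<And>vs. vs \<in> S \<Longrightarrow> length vs = Suc n \<and> hd vs = u \<and> last vs = v"
  shows "(\<Sum>vs\<in>S. path_weight g vs) \<le> K ^ n * h u v"
  using assms(5,6)
proof (induction n arbitrary: S u)
  case 0
  have "S \<subseteq> (if u = v then {[u]} else {})"
  proof
    fix vs assume "vs \<in> S"
    then show "vs \<in> (if u = v then {[u]} else {})"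
      using "0.prems"(2)[of vs] by (cases vs) auto
  qed
  then have "(\<Sum>vs\<in>S. path_weight g vs)
      \<le> (\<Sum>vs\<in>(if u = v then {[u]} else {}). path_weight g vs)"
    by (intro sum_mono2) (auto intro: path_weight_nonneg g)
  also have "\<dots> \<le> h u v"
    using h[of u v] diag[of v] by auto
  finally show ?case by simp
next
  case (Suc n)
  \<comment> \<open>The empty sum in the hypothesis on the kernel already forces this.\<close>
  have K0: "0 \<le> K"
    using step[of "{}" v v] diag[of v] by (auto simp: zero_le_mult_iff)
  define T where "T = tl ` S"
  define Z where "Z = hd ` T"
  have fin: "finite T" "finite Z" using Suc.prems(1) by (auto simp: T_def Z_def)
  have shape: "\<exists>z zs. vs = u # z # zs" if "vs \<in> S" for vs
    using Suc.prems(2)[OF that] by (cases vs; cases "tl vs") auto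
  have inj: "inj_on tl S"
  proof (rule inj_onI)
    fix vs ws assume "vs \<in> S" "ws \<in> S" "tl vs = tl ws"
    then show "vs = ws" using shape[of vs] shape[of ws] by auto
  qed
  have weight: "path_weight g vs = g u (hd (tl vs)) * path_weight g (tl vs)" if "vs \<in> S" for vs
    using shape[OF that] by auto
  have "(\<Sum>vs\<in>S. path_weight g vs) = (\<Sum>vs\<in>S. g u (hd (tl vs)) * path_weight g (tl vs))"
    by (intro sum.cong weight refl)
  also have "\<dots> = (\<Sum>ws\<in>T. g u (hd ws) * path_weight g ws)"
    unfolding T_def by (subst sum.reindex[OF inj]) simp
  also have "\<dots> = (\<Sum>z\<in>Z. \<Sum>ws\<in>{ws\<in>T. hd ws = z}. g u (hd ws) * path_weight g ws)"
    using fin by (intro sum.group[symmetric]) (auto simp: Z_def)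
  also have "\<dots> = (\<Sum>z\<in>Z. g u z * (\<Sum>ws\<in>{ws\<in>T. hd ws = z}. path_weight g ws))"
    by (simp add: sum_distrib_left)
  also have "\<dots> \<le> (\<Sum>z\<in>Z. g u z * (K ^ n * h z v))"
  proof (intro sum_mono mult_left_mono g Suc.IH)
    fix z assume "z \<in> Z"
    show "finite {ws \<in> T. hd ws = z}" using fin by auto
    fix ws assume ws: "ws \<in> {ws \<in> T. hd ws = z}"
    then obtain vs where vs: "vs \<in> S" "ws = tl vs" by (auto simp: T_def)
    show "length ws = Suc n \<and> hd ws = z \<and> last ws = v"
      using shape[OF vs(1)] Suc.prems(2)[OF vs(1)] vs(2) ws by auto
  qed
  also have "\<dots> = K ^ n * (\<Sum>z\<in>Z. g u z * h z v)"
    by (simp add: sum_distrib_left ac_simps)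
  also have "\<dots> \<le> K ^ n * (K * h u v)"
    using step[OF fin(2)] K0 by (intro mult_left_mono) auto
  finally show ?case by (simp add: ac_simps)
qed

lemma path_weight_mono:
  fixes g h :: "'v \<Rightarrow> 'v \<Rightarrow> real"
  assumes "distinct vs" "\<And>u v. u \<noteq> v \<Longrightarrow> 0 \<le> g u v \<and> g u v \<le> h u v"
  shows "0 \<le> path_weight g vs \<and> path_weight g vs \<le> path_weight h vs"
  using assms
proof (induction g vs rule: path_weight.induct)
  case (1 g u v vs)
  then show ?case using "1.prems"(2)[of u v] by (auto intro!: mult_mono intro: order_trans)
qed auto

text \<open>A vertex of a self-avoiding path lies on at most two of its edges, hence contributes at most its
  square. The proof keeps a spare factor for the first vertex, which lies on one edge only.\<close>

lemma path_weight_vertices_le: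
  fixes Z :: "'v \<Rightarrow> real"
  assumes "distinct vs" "\<And>v. 1 \<le> Z v"
  shows "path_weight (\<lambda>u v. Z u * Z v) vs \<le> (\<Prod>v\<in>set vs. Z v ^ 2)"
proof (cases vs)
  case (Cons u ws)
  have Z0: "0 \<le> Z v" for v using assms(2)[of v] by linarith
  \<comment> \<open>The factor in front makes the induction go through: the next step uses it up.\<close>
  have "Z u * path_weight (\<lambda>u v. Z u * Z v) (u # ws) \<le> (\<Prod>v\<in>set (u # ws). Z v ^ 2)"
    if "distinct (u # ws)" using that
  proof (induction ws arbitrary: u)
    case Nil
    then show ?case using assms(2)[of u] by (simp add: power2_eq_square mult_le_cancel_left1)
  next
    case (Cons v ws)
    then have "(Z v * path_weight (\<lambda>u v. Z u * Z v) (v # ws)) \<le> (\<Prod>v\<in>set (v # ws). Z v ^ 2)" by simp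
    then have "Z u ^ 2 * (Z v * path_weight (\<lambda>u v. Z u * Z v) (v # ws)) \<le> Z u ^ 2 * (\<Prod>v\<in>set (v # ws). Z v ^ 2)"
      by (intro mult_left_mono) auto
    then show ?case using Cons.prems by (simp add: power2_eq_square ac_simps)
  qed
  moreover have "1 * path_weight (\<lambda>u v. Z u * Z v) vs \<le> Z u * path_weight (\<lambda>u v. Z u * Z v) vs"
    using Z0 assms(2) by (intro mult_right_mono path_weight_nonneg) auto
  ultimately show ?thesis using assms(1) Cons by simp
qed auto

fun path_edges :: "'v list \<Rightarrow> 'v set set" where
  "path_edges (u # v # vs) = insert {u, v} (path_edges (v # vs))"
| "path_edges vs = {}"

lemma finite_path_edges [simp]: "finite (path_edges vs)"
  by (induction vs rule: path_edges.induct) auto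

lemma Union_path_edges: "\<Union> (path_edges vs) \<subseteq> set vs"
  by (induction vs rule: path_edges.induct) auto

lemma path_edges_complete: "distinct vs \<Longrightarrow> path_edges vs \<subseteq> complete_edges"
  by (induction vs rule: path_edges.induct) (auto simp: complete_edges_def)

lemma successively_iff_path_edges: "successively (\<lambda>u v. {u, v} \<in> E) vs \<longleftrightarrow> path_edges vs \<subseteq> E"
  by (induction vs rule: path_edges.induct) auto

text \<open>A self-avoiding path does not traverse an edge twice, so a product over its edge set can be taken
  step by step.\<close>

lemma prod_path_edges:
  "distinct vs \<Longrightarrow> (\<Prod>e\<in>path_edges vs. f e) = path_weight (\<lambda>u v. f {u, v}) vs"
proof (induction vs rule: path_edges.induct)
  case (1 u v vs)
  have "{u, v} \<notin> path_edges (v # vs)" using Union_path_edges[of "v # vs"] "1.prems" by auto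
  then show ?case using 1 by simp
qed auto

section \<open>Polynomial decay on the integer lattice\<close>

lemma euclid_norm_triangle: "euclid_norm (x + y) \<le> euclid_norm x + euclid_norm y"
proof -
  have "(\<chi> i. real_of_int ((x + y) $ i)) = (\<chi> i. real_of_int (x $ i)) + (\<chi> i. real_of_int (y $ i))"
    by (simp add: vec_eq_iff)
  then show ?thesis unfolding euclid_norm_def by (simp add: norm_triangle_ineq)
qed

lemma abs_component_le_euclid_norm: "\<bar>real_of_int (x $ i)\<bar> \<le> euclid_norm x"
  unfolding euclid_norm_def
  using component_le_norm_cart[of "\<chi> i. real_of_int (x $ i)" i] by simp

lemma euclid_norm_ge_1:
  assumes "x \<noteq> 0" shows "1 \<le> euclid_norm x"
proof -
  obtain i where "x $ i \<noteq> 0" using assms by (auto simp: vec_eq_iff)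
  then have "1 \<le> \<bar>real_of_int (x $ i)\<bar>" by linarith
  then show ?thesis using abs_component_le_euclid_norm[of x i] by linarith
qed

lemma euclid_norm_zero [simp]: "euclid_norm 0 = 0"
  unfolding euclid_norm_def by (simp add: vec_eq_iff)

lemma euclid_norm_minus: "euclid_norm (- x) = euclid_norm x"
proof -
  have "(\<chi> i. real_of_int ((- x) $ i)) = - (\<chi> i. real_of_int (x $ i))"
    by (simp add: vec_eq_iff)
  then show ?thesis unfolding euclid_norm_def by simp
qed

text \<open>Truncating the norm at \<open>1\<close> gives the value \<open>1\<close> at the origin and changes nothing elsewhere, as nonzero
  lattice points have norm at least \<open>1\<close>; the convolution bound below then holds at every point,
  including the origin.\<close>

definition decay :: "real \<Rightarrow> int ^ 'd \<Rightarrow> real" where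
  "decay \<beta> x = max 1 (euclid_norm x) powr (- \<beta>)"

lemma decay_nonneg: "0 \<le> decay \<beta> x"
  by (simp add: decay_def)

lemma decay_zero [simp]: "decay \<beta> 0 = 1"
  by (simp add: decay_def)

lemma decay_nonzero: "x \<noteq> 0 \<Longrightarrow> decay \<beta> x = euclid_norm x powr (- \<beta>)"
  using euclid_norm_ge_1[of x] by (simp add: decay_def max_absorb2)

text \<open>By the triangle inequality, the longer of two steps is at least half as long as their sum, so the
  factor belonging to it is at most \<open>2 powr \<beta>\<close> times the decay of the sum.\<close>

lemma decay_mult_le:
  assumes "0 \<le> \<beta>"
  shows "decay \<beta> x * decay \<beta> y \<le> 2 powr \<beta> * decay \<beta> (x + y) * (decay \<beta> x + decay \<beta> y)"
proof -
  have larger: "decay \<beta> u \<le> 2 powr \<beta> * decay \<beta> (x + y)"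
    if "max 1 (euclid_norm (x + y)) \<le> 2 * max 1 (euclid_norm u)" for u
  proof -
    have "decay \<beta> u \<le> (max 1 (euclid_norm (x + y)) / 2) powr (- \<beta>)"
      unfolding decay_def using that assms by (intro powr_mono2') auto
    also have "\<dots> = 2 powr \<beta> * decay \<beta> (x + y)"
      by (simp add: decay_def powr_divide powr_minus field_simps)
    finally show ?thesis .
  qed
  note tri = euclid_norm_triangle[of x y]
  consider "max 1 (euclid_norm (x + y)) \<le> 2 * max 1 (euclid_norm x)"
    | "max 1 (euclid_norm (x + y)) \<le> 2 * max 1 (euclid_norm y)"
    using tri by (cases "euclid_norm x \<le> euclid_norm y") (auto simp: max_def split: if_splits)
  then show ?thesis
  proof cases
    case 1
    have "decay \<beta> x * decay \<beta> y \<le> 2 powr \<beta> * decay \<beta> (x + y) * decay \<beta> y"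
      by (intro mult_right_mono larger 1 decay_nonneg)
    also have "\<dots> \<le> 2 powr \<beta> * decay \<beta> (x + y) * (decay \<beta> x + decay \<beta> y)"
      by (intro mult_left_mono) (auto simp: decay_nonneg)
    finally show ?thesis .
  next
    case 2
    have "decay \<beta> x * decay \<beta> y \<le> decay \<beta> x * (2 powr \<beta> * decay \<beta> (x + y))"
      by (intro mult_left_mono larger 2 decay_nonneg)
    also have "\<dots> \<le> (decay \<beta> x + decay \<beta> y) * (2 powr \<beta> * decay \<beta> (x + y))"
      by (intro mult_right_mono) (auto simp: decay_nonneg)
    finally show ?thesis by (simp add: ac_simps)
  qed
qed

lemma sum_int_powr_bounded:
  fixes b :: real
  assumes "b > 1"
  obtains C where "0 \<le> C" "\<And>A :: int set. finite A \<Longrightarrow> (\<Sum>k\<in>A. max 1 \<bar>real_of_int k\<bar> powr (- b)) \<le> C"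
proof -
  define f where "f k = max 1 \<bar>real_of_int k\<bar> powr (- b)" for k :: int
  have "summable (\<lambda>n. real n powr (- b))"
    using assms by (simp add: summable_real_powr_iff)
  then have sm: "summable (\<lambda>n. f (int n))"
    by (subst summable_cong[of _ "\<lambda>n. real n powr (- b)"])
       (auto intro!: eventually_mono[OF eventually_ge_at_top[of 1]] simp: f_def max_def)
  define G where "G = (\<Sum>n. f (int n))"
  have fpos: "0 \<le> f k" for k by (simp add: f_def)
  have "(\<Sum>k\<in>A. f k) \<le> 2 * G" if "finite A" for A :: "int set"
  proof -
    define N where "N = (nat \<circ> abs) ` A"
    have fN: "finite N" using that by (simp add: N_def)
    have "A \<subseteq> int ` N \<union> (\<lambda>n. - int n) ` N"
    proof
      fix k assume "k \<in> A"
      then have "nat \<bar>k\<bar> \<in> N" by (auto simp: N_def)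
      moreover have "k = int (nat \<bar>k\<bar>) \<or> k = - int (nat \<bar>k\<bar>)" by auto
      ultimately show "k \<in> int ` N \<union> (\<lambda>n. - int n) ` N" by blast
    qed
    then have "(\<Sum>k\<in>A. f k) \<le> (\<Sum>k\<in>int ` N \<union> (\<lambda>n. - int n) ` N. f k)"
      using fN fpos by (intro sum_mono2) auto
    also have "\<dots> \<le> (\<Sum>k\<in>int ` N. f k) + (\<Sum>k\<in>(\<lambda>n. - int n) ` N. f k)"
      using sum.union_inter[of "int ` N" "(\<lambda>n. - int n) ` N" f] fN
        sum_nonneg[of "int ` N \<inter> (\<lambda>n. - int n) ` N" f] fpos by simp
    also have "(\<Sum>k\<in>int ` N. f k) = (\<Sum>n\<in>N. f (int n))"
      by (subst sum.reindex) (auto simp: inj_on_def)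
    also have "(\<Sum>k\<in>(\<lambda>n. - int n) ` N. f k) = (\<Sum>n\<in>N. f (int n))"
      by (subst sum.reindex) (auto simp: inj_on_def f_def)
    also have "(\<Sum>n\<in>N. f (int n)) \<le> G"
      unfolding G_def using sm fN fpos by (intro sum_le_suminf) auto
    finally show ?thesis by simp
  qed
  moreover have "0 \<le> 2 * G" unfolding G_def using fpos sm by (simp add: suminf_nonneg)
  ultimately show ?thesis using that[of "2 * G"] by (simp add: f_def)
qed

text \<open>The Euclidean norm dominates each coordinate, so the decay is at most a product of one-dimensional
  decays with exponent \<open>\<beta> / d > 1\<close>, and the sum over a box factorises.\<close>

lemma sum_decay_bounded:
  assumes "\<beta> > real CARD('d)"
  obtains G where "0 \<le> G" "\<And>Z :: (int ^ 'd) set. finite Z \<Longrightarrow> (\<Sum>z\<in>Z. decay \<beta> z) \<le> G"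
proof -
  define n where "n = real CARD('d)"
  have n: "n > 0" by (simp add: n_def)
  define f where "f k = max 1 \<bar>real_of_int k\<bar> powr (- (\<beta> / n))" for k :: int
  have "\<beta> / n > 1" using assms n by (simp add: n_def)
  then obtain C where C: "0 \<le> C" "\<And>A. finite A \<Longrightarrow> (\<Sum>k\<in>A. f k) \<le> C"
    unfolding f_def by (rule sum_int_powr_bounded) blast
  have "(\<Sum>z\<in>Z. decay \<beta> z) \<le> C ^ CARD('d)" if "finite Z" for Z :: "(int ^ 'd) set"
  proof -
    have le_prod: "decay \<beta> z \<le> (\<Prod>i\<in>UNIV. f (z $ i))" for z :: "int ^ 'd"
    proof -
      have "decay \<beta> z = (\<Prod>i\<in>(UNIV :: 'd set). max 1 (euclid_norm z) powr (- (\<beta> / n)))"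
        using n by (simp add: decay_def powr_realpow[symmetric] powr_powr n_def)
      also have "\<dots> \<le> (\<Prod>i\<in>UNIV. f (z $ i))"
        unfolding f_def using abs_component_le_euclid_norm[of z] assms n
        by (intro prod_mono conjI powr_mono2') (auto simp: n_def intro: max.coboundedI2)
      finally show ?thesis .
    qed
    define A where "A = (\<Union>z\<in>Z. range (($) z))"
    have fA: "finite A" using that by (simp add: A_def)
    have "(\<Sum>z\<in>Z. decay \<beta> z) \<le> (\<Sum>z\<in>Z. \<Prod>i\<in>UNIV. f (z $ i))"
      by (intro sum_mono le_prod)
    also have "\<dots> = (\<Sum>p\<in>($) ` Z. \<Prod>i\<in>UNIV. f (p i))"
      by (subst sum.reindex) (auto simp: inj_on_def vec_nth_inject)
    also have "\<dots> \<le> (\<Sum>p\<in>PiE (UNIV :: 'd set) (\<lambda>_. A). \<Prod>i\<in>UNIV. f (p i))"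
    proof (rule sum_mono2)
      show "finite (PiE (UNIV :: 'd set) (\<lambda>_. A))" using fA by (intro finite_PiE) auto
      show "($) ` Z \<subseteq> PiE UNIV (\<lambda>_. A)" by (auto simp: A_def)
    qed (auto simp: f_def intro!: prod_nonneg)
    also have "\<dots> = (\<Prod>i\<in>(UNIV :: 'd set). \<Sum>k\<in>A. f k)"
      using fA by (subst prod_sum_PiE) auto
    also have "\<dots> \<le> (\<Prod>i\<in>(UNIV :: 'd set). C)"
      using C(2)[OF fA] by (intro prod_mono) (auto simp: f_def intro!: sum_nonneg)
    finally show ?thesis by simp
  qed
  then show ?thesis using that[of "C ^ CARD('d)"] C(1) by simp
qed

lemma decay_convolution:
  assumes "\<beta> > real CARD('d)"
  obtains K where "0 \<le> K"
    "\<And>Z (x :: int ^ 'd) y. finite Z \<Longrightarrow> (\<Sum>z\<in>Z. decay \<beta> (z - x) * decay \<beta> (y - z)) \<le> K * decay \<beta> (y - x)"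
proof -
  obtain G where G: "0 \<le> G" "\<And>Z :: (int ^ 'd) set. finite Z \<Longrightarrow> (\<Sum>z\<in>Z. decay \<beta> z) \<le> G"
    using sum_decay_bounded[OF assms] by blast
  have "0 \<le> \<beta>" using assms by (meson le_less_trans less_imp_le of_nat_0_le_iff)
  have "(\<Sum>z\<in>Z. decay \<beta> (z - x) * decay \<beta> (y - z)) \<le> (2 powr \<beta> * (2 * G)) * decay \<beta> (y - x)"
    if Z: "finite Z" for Z and x y :: "int ^ 'd"
  proof -
    have "(\<Sum>z\<in>Z. decay \<beta> (z - x) * decay \<beta> (y - z))
        \<le> (\<Sum>z\<in>Z. 2 powr \<beta> * decay \<beta> (y - x) * (decay \<beta> (z - x) + decay \<beta> (y - z)))"
      using decay_mult_le[OF \<open>0 \<le> \<beta>\<close>, of "z - x" "y - z" for z] by (intro sum_mono) simp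
    also have "\<dots> = 2 powr \<beta> * decay \<beta> (y - x) * ((\<Sum>z\<in>Z. decay \<beta> (z - x)) + (\<Sum>z\<in>Z. decay \<beta> (y - z)))"
      by (simp add: sum_distrib_left[symmetric] sum.distrib)
    also have "(\<Sum>z\<in>Z. decay \<beta> (z - x)) = (\<Sum>z\<in>(\<lambda>z. z - x) ` Z. decay \<beta> z)"
      by (subst sum.reindex) (auto simp: inj_on_def)
    also have "(\<Sum>z\<in>Z. decay \<beta> (y - z)) = (\<Sum>z\<in>(\<lambda>z. y - z) ` Z. decay \<beta> z)"
      by (subst sum.reindex) (auto simp: inj_on_def)
    also have "2 powr \<beta> * decay \<beta> (y - x) *
        ((\<Sum>z\<in>(\<lambda>z. z - x) ` Z. decay \<beta> z) + (\<Sum>z\<in>(\<lambda>z. y - z) ` Z. decay \<beta> z))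
        \<le> 2 powr \<beta> * decay \<beta> (y - x) * (G + G)"
      using Z by (intro mult_left_mono add_mono G(2)) (auto simp: decay_nonneg)
    finally show ?thesis by (simp add: ac_simps)
  qed
  then show ?thesis using that[of "2 powr \<beta> * (2 * G)"] G(1) by simp
qed

section \<open>Tails, moments and countable unions\<close>

text \<open>This form of countable subadditivity asks only for a uniform bound on the finite sums, which is what
  \<open>sum_path_weight_le\<close> provides.\<close>

lemma (in finite_measure) measure_UN_le_of_finite_sums:
  assumes "countable I" and A: "\<And>i. i \<in> I \<Longrightarrow> A i \<in> sets M"
    and B: "\<And>J. finite J \<Longrightarrow> J \<subseteq> I \<Longrightarrow> (\<Sum>j\<in>J. measure M (A j)) \<le> B"
  shows "measure M (\<Union>i\<in>I. A i) \<le> B"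
proof (cases "I = {}")
  case True
  then show ?thesis using B[of "{}"] by simp
next
  case False
  define f where "f = from_nat_into I"
  have range: "range f = I"
    using \<open>countable I\<close> False by (simp add: f_def)
  then have fI: "f n \<in> I" for n by blast
  define U where "U n = (\<Union>k\<le>n. A (f k))" for n
  have "(\<lambda>n. measure M (U n)) \<longlonglongrightarrow> measure M (\<Union>n. U n)"
  proof (rule finite_Lim_measure_incseq)
    show "range U \<subseteq> sets M" using A fI by (auto simp: U_def)
    show "incseq U" unfolding U_def incseq_def by (fastforce intro: order_trans)
  qed
  also have "(\<Union>n. U n) = (\<Union>i\<in>I. A i)"
    by (auto simp: U_def range[symmetric])
  finally have lim: "(\<lambda>n. measure M (U n)) \<longlonglongrightarrow> measure M (\<Union>i\<in>I. A i)" .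
  have "measure M (U n) \<le> B" for n
  proof -
    have "U n = (\<Union>j\<in>f ` {..n}. A j)" by (auto simp: U_def)
    then have "measure M (U n) \<le> (\<Sum>j\<in>f ` {..n}. measure M (A j))"
      using A fI by (simp only:) (intro measure_UNION_le, auto)
    also have "\<dots> \<le> B" using fI by (intro B) auto
    finally show ?thesis .
  qed
  then show ?thesis by (intro LIMSEQ_le_const2[OF lim]) auto
qed

text \<open>Dyadic decomposition: on \<open>{2 ^ k < X \<le> 2 ^ (k + 1)}\<close> the integrand is at most
  \<open>2 powr (q * (k + 1))\<close>, so the tail bound leaves a geometric series with ratio \<open>2 powr (q - s)\<close>.\<close>

lemma (in prob_space) nn_integral_powr_le_of_tail:
  fixes X :: "'a \<Rightarrow> real"
  assumes X [measurable]: "X \<in> borel_measurable M" and q: "0 \<le> q" "q < s" and "0 \<le> c"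
    and tail: "\<And>w. 0 < w \<Longrightarrow> prob {\<omega> \<in> space M. w < X \<omega>} \<le> c * w powr (- s)"
  shows "(\<integral>\<^sup>+\<omega>. ennreal (max 1 (X \<omega>) powr q) \<partial>M) \<le> ennreal (1 + 2 powr q * c / (1 - 2 powr (q - s)))"
proof -
  define T where "T k = {\<omega> \<in> space M. 2 ^ k < X \<omega>}" for k :: nat
  have [measurable]: "T k \<in> sets M" for k by (simp add: T_def)
  define a where "a k = ennreal (2 powr (q * real (Suc k)))" for k
  have dyadic: "ennreal (max 1 (X \<omega>) powr q) \<le> 1 + (\<Sum>k. a k * indicator (T k) \<omega>)"
    if "\<omega> \<in> space M" for \<omega>
  proof (cases "X \<omega> \<le> 1")
    case True
    then show ?thesis by (simp add: max_absorb1)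
  next
    case False
    define n where "n = (LEAST n. X \<omega> \<le> 2 ^ n)"
    have ex: "\<exists>n. X \<omega> \<le> 2 ^ n"
      using real_arch_pow[of 2 "X \<omega>"] by (auto intro: less_imp_le)
    have le: "X \<omega> \<le> 2 ^ n" unfolding n_def by (rule LeastI_ex[OF ex])
    obtain k where k: "n = Suc k" using le False by (cases n) auto
    have "\<omega> \<in> T k"
      using not_less_Least[of k "\<lambda>n. X \<omega> \<le> 2 ^ n"] that k by (auto simp: T_def n_def not_le)
    have "max 1 (X \<omega>) powr q \<le> (2 ^ Suc k) powr q"
      using le False q k by (intro powr_mono2) auto
    also have "\<dots> = 2 powr (q * real (Suc k))"
      by (subst powr_realpow[symmetric], simp, subst powr_powr) (simp add: ac_simps)
    finally have "ennreal (max 1 (X \<omega>) powr q) \<le> a k * indicator (T k) \<omega>"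
      using \<open>\<omega> \<in> T k\<close> by (simp add: a_def ennreal_leI)
    also have "\<dots> \<le> (\<Sum>k. a k * indicator (T k) \<omega>)"
    proof -
      define F where "F j = a j * indicator (T j) \<omega>" for j
      have "sum F {k} \<le> suminf F" by (rule sum_le_suminf) auto
      then have "F k \<le> suminf F" by simp
      then show ?thesis unfolding F_def .
    qed
    also have "\<dots> \<le> 1 + (\<Sum>k. a k * indicator (T k) \<omega>)" by simp
    finally show ?thesis .
  qed
  define r where "r = 2 powr (q - s)"
  have r: "0 < r" "r < 1" using q by (auto simp: r_def powr_less_one)
  have "(\<integral>\<^sup>+\<omega>. ennreal (max 1 (X \<omega>) powr q) \<partial>M) \<le> (\<integral>\<^sup>+\<omega>. 1 + (\<Sum>k. a k * indicator (T k) \<omega>) \<partial>M)"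
    by (intro nn_integral_mono dyadic)
  also have "\<dots> = 1 + (\<Sum>k. a k * emeasure M (T k))"
    by (subst nn_integral_add) (auto simp: nn_integral_suminf nn_integral_cmult emeasure_space_1)
  also have "(\<Sum>k. a k * emeasure M (T k)) \<le> (\<Sum>k. ennreal (2 powr q * c * r ^ k))"
  proof (intro suminf_le summableI)
    fix k
    have "prob (T k) \<le> c * (2 ^ k) powr (- s)"
      unfolding T_def by (intro tail) simp
    then have "2 powr (q * real (Suc k)) * prob (T k) \<le> 2 powr (q * real (Suc k)) * (c * (2 ^ k) powr (- s))"
      by (intro mult_left_mono) auto
    also have "(2 ^ k :: real) powr (- s) = 2 powr (- s * real k)"
      by (subst powr_realpow[symmetric], simp, subst powr_powr) (simp add: ac_simps)
    also have "2 powr (q * real (Suc k)) * (c * 2 powr (- s * real k)) = 2 powr q * c * 2 powr ((q - s) * real k)"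
      by (simp add: powr_add[symmetric] algebra_simps)
    also have "2 powr ((q - s) * real k) = r ^ k"
      unfolding r_def by (subst powr_realpow[symmetric]) (auto simp: powr_powr)
    finally show "a k * emeasure M (T k) \<le> ennreal (2 powr q * c * r ^ k)"
      by (simp add: a_def emeasure_eq_measure ennreal_mult'[symmetric] ennreal_leI)
  qed
  also have "(\<Sum>k. ennreal (2 powr q * c * r ^ k)) = ennreal (2 powr q * c * (1 / (1 - r)))"
    using r \<open>0 \<le> c\<close> by (intro suminf_ennreal_eq sums_mult geometric_sums) auto
  finally have "(\<integral>\<^sup>+\<omega>. ennreal (max 1 (X \<omega>) powr q) \<partial>M) \<le> 1 + ennreal (2 powr q * c / (1 - r))"
    by (simp add: add_left_mono)
  also have "1 + ennreal (2 powr q * c / (1 - r)) = ennreal (1 + 2 powr q * c / (1 - r))"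
    using r \<open>0 \<le> c\<close> by (subst ennreal_plus) auto
  finally show ?thesis unfolding r_def .
qed

text \<open>Interpolation between the two trivial bounds \<open>1\<close> and \<open>u\<close>. It trades spatial decay of the edge
  probabilities for a lower moment of the weights.\<close>

lemma one_minus_exp_le_powr:
  fixes u t :: real
  assumes "0 \<le> u" "0 < t" "t \<le> 1"
  shows "1 - exp (- u) \<le> u powr t"
proof (cases "u \<le> 1")
  case True
  have "1 - exp (- u) \<le> u" using exp_ge_add_one_self[of "- u"] by linarith
  also have "u = u powr 1" using assms by simp
  also have "\<dots> \<le> u powr t" using True assms by (intro powr_mono') auto
  finally show ?thesis .
next
  case False
  then have "1 \<le> u powr t" using assms by (intro ge_one_powr_ge_zero) auto
  then show ?thesis using exp_gt_zero[of "- u"] by linarith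
qed

section \<open>Graph distance and path lengths\<close>

text \<open>The graph distance takes values in the extended natural numbers; rounding \<open>r\<close> up to an integer
  allows the infimum over paths to be compared within that type.\<close>

lemma le_graph_dist_iff:
  "ereal r \<le> ereal_of_enat (graph_dist E x y) \<longleftrightarrow> (\<forall>vs\<in>graph_paths E x y. r \<le> real (length vs - 1))"
proof
  assume le: "ereal r \<le> ereal_of_enat (graph_dist E x y)"
  show "\<forall>vs\<in>graph_paths E x y. r \<le> real (length vs - 1)"
  proof
    fix vs assume "vs \<in> graph_paths E x y"
    then have "graph_dist E x y \<le> enat (length vs - 1)"
      unfolding graph_dist_def by (rule INF_lower)
    then have "ereal_of_enat (graph_dist E x y) \<le> ereal_of_enat (enat (length vs - 1))"
      by (simp only: ereal_of_enat_le_iff)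
    with le have "ereal r \<le> ereal_of_enat (enat (length vs - 1))" by (rule order_trans)
    then show "r \<le> real (length vs - 1)" by simp
  qed
next
  assume all: "\<forall>vs\<in>graph_paths E x y. r \<le> real (length vs - 1)"
  have "enat (nat \<lceil>r\<rceil>) \<le> graph_dist E x y"
    unfolding graph_dist_def
  proof (rule INF_greatest)
    fix vs assume "vs \<in> graph_paths E x y"
    with all have "r \<le> real (length vs - 1)" by blast
    then have "nat \<lceil>r\<rceil> \<le> length vs - 1" by (simp add: nat_le_iff ceiling_le_iff)
    then show "enat (nat \<lceil>r\<rceil>) \<le> enat (length vs - 1)" by simp
  qed
  then have "ereal_of_enat (enat (nat \<lceil>r\<rceil>)) \<le> ereal_of_enat (graph_dist E x y)"
    by (simp only: ereal_of_enat_le_iff)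
  moreover have "ereal r \<le> ereal_of_enat (enat (nat \<lceil>r\<rceil>))"
    by (simp add: real_nat_ceiling_ge)
  ultimately show "ereal r \<le> ereal_of_enat (graph_dist E x y)" by (rule order_trans[rotated])
qed

section \<open>Occupied paths in scale-free percolation\<close>

context scale_free_percolation
begin

lemma weight_measurable [measurable]: "W x \<in> borel_measurable M"
  using weights_indep by (auto simp: indep_vars_def)

lemma occ_sets: "e \<in> complete_edges \<Longrightarrow> occ e \<in> sets M"
  using edges_cond_indep by (auto simp: cond_indep_events_def)

lemma subalgebra_weight_algebra: "subalgebra M (weight_algebra M W)"
  unfolding subalgebra_def weight_algebra_def
proof
  have "(\<lambda>\<omega> x. W x \<omega>) \<in> measurable M (\<Pi>\<^sub>M x\<in>UNIV. borel)"
    by (rule measurable_PiM_single') (simp_all add: weight_measurable)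
  then show "sets (vimage_algebra (space M) (\<lambda>\<omega> x. W x \<omega>) (\<Pi>\<^sub>M x\<in>UNIV. borel)) \<subseteq> sets M"
    by (intro sets_image_in_sets) simp_all
qed simp

lemma
  assumes "A \<in> sets M"
  shows integrable_cond_prob: "integrable M (cond_prob_given M (weight_algebra M W) A)"
    and integral_cond_prob: "(\<integral>\<omega>. cond_prob_given M (weight_algebra M W) A \<omega> \<partial>M) = prob A"
proof -
  interpret S: finite_measure_subalgebra M "weight_algebra M W"
    by unfold_locales (rule subalgebra_weight_algebra)
  have "integrable M (indicator A :: 'a \<Rightarrow> real)" using assms by (simp add: less_top[symmetric])
  from S.real_cond_exp_int[OF this] show
    "integrable M (cond_prob_given M (weight_algebra M W) A)"
    "(\<integral>\<omega>. cond_prob_given M (weight_algebra M W) A \<omega> \<partial>M) = prob A"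
    using assms by (auto simp: cond_prob_given_def)
qed

text \<open>The intersection with the sample space matters only for paths without edges, whose intersection of
  edge events would otherwise be the whole type.\<close>

definition path_event :: "(int ^ 'd) list \<Rightarrow> 'a set" where
  "path_event vs = space M \<inter> (\<Inter>e\<in>path_edges vs. occ e)"

lemma path_event_sets: "distinct vs \<Longrightarrow> path_event vs \<in> sets M"
  unfolding path_event_def using path_edges_complete[of vs] occ_sets
  by (cases "path_edges vs = {}") (auto intro!: sets.Int sets.finite_INT)

text \<open>The bound splits into a deterministic spatial factor and one factor for each endpoint. Replacing
  \<open>W\<close> by \<open>max 1 W\<close> makes the vertex factors at least \<open>1\<close>, so that endpoints and interior vertices of
  a path can be treated alike.\<close>

lemma cond_prob_edge_bounds:
  assumes "0 < lam" "0 < t" "t \<le> 1"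
  shows "AE \<omega> in M. \<forall>u v. u \<noteq> v \<longrightarrow>
    0 \<le> cond_prob_given M (weight_algebra M W) (occ {u, v}) \<omega> \<and>
    cond_prob_given M (weight_algebra M W) (occ {u, v}) \<omega> \<le>
      (lam powr t * decay (alpha * t) (v - u)) * (max 1 (W u \<omega>) powr t * max 1 (W v \<omega>) powr t)"
proof -
  have "AE \<omega> in M. \<forall>u v. u \<noteq> v \<longrightarrow> cond_prob_given M (weight_algebra M W) (occ {u, v}) \<omega> =
      1 - exp (- (lam * W u \<omega> * W v \<omega> / euclid_norm (u - v) powr alpha))"
    unfolding AE_all_countable using edges_cond_prob by auto
  moreover have "AE \<omega> in M. \<forall>u. 0 \<le> W u \<omega>"
    unfolding AE_all_countable using weights_nonneg by auto
  ultimately show ?thesis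
  proof eventually_elim
    case (elim \<omega>)
    show ?case
    proof (intro allI impI)
      fix u v :: "int ^ 'd" assume "u \<noteq> v"
      define n where "n = euclid_norm (u - v)"
      define y where "y = lam * W u \<omega> * W v \<omega> / n powr alpha"
      have n: "1 \<le> n" unfolding n_def using \<open>u \<noteq> v\<close> by (intro euclid_norm_ge_1) simp
      have y: "0 \<le> y" using elim assms by (simp add: y_def)
      have dec: "decay (alpha * t) (v - u) = n powr (- (alpha * t))"
        using \<open>u \<noteq> v\<close> euclid_norm_minus[of "u - v"] by (simp add: decay_nonzero n_def)
      have "1 - exp (- y) \<le> y powr t" using y assms by (intro one_minus_exp_le_powr)
      also have "y powr t = (lam powr t * n powr (- (alpha * t))) * (W u \<omega> powr t * W v \<omega> powr t)"
        using elim assms n unfolding y_def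
        by (simp add: powr_mult powr_divide powr_powr powr_minus field_simps)
      also have "\<dots> \<le> (lam powr t * n powr (- (alpha * t))) * (max 1 (W u \<omega>) powr t * max 1 (W v \<omega>) powr t)"
        using elim assms by (intro mult_left_mono mult_mono powr_mono2) auto
      finally have "1 - exp (- y) \<le> \<dots>" .
      moreover have "0 \<le> 1 - exp (- y)" using y by simp
      ultimately show "0 \<le> cond_prob_given M (weight_algebra M W) (occ {u, v}) \<omega> \<and>
        cond_prob_given M (weight_algebra M W) (occ {u, v}) \<omega> \<le>
        (lam powr t * decay (alpha * t) (v - u)) * (max 1 (W u \<omega>) powr t * max 1 (W v \<omega>) powr t)"
        using elim(1) \<open>u \<noteq> v\<close> unfolding dec by (simp add: y_def n_def)
    qed
  qed
qed

text \<open>Given the weights the edges are independent, so the conditional probability of the path is a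
  product over its edges. After the edge bounds are collected by vertices, the independence of the weights
  splits the expectation into one moment for each vertex.\<close>

lemma prob_path_event_le:
  assumes "0 < lam" "0 < t" "t \<le> 1" and vs: "distinct vs"
    and m: "1 \<le> m" "\<And>x. (\<integral>\<^sup>+\<omega>. ennreal (max 1 (W x \<omega>) powr (2 * t)) \<partial>M) \<le> ennreal m"
  shows "prob (path_event vs) \<le> m ^ length vs *
    path_weight (\<lambda>u v. lam powr t * decay (alpha * t) (v - u)) vs"
proof -
  define E where "E = path_edges vs"
  define w where "w = path_weight (\<lambda>u v. lam powr t * decay (alpha * t) (v - u)) vs"
  define Z where "Z x \<omega> = max 1 (W x \<omega>) powr t" for x \<omega>
  have w0: "0 \<le> w" unfolding w_def by (intro path_weight_nonneg) (simp add: decay_nonneg)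
  show ?thesis
  proof (cases "E = {}")
    case True
    then have "w = 1" unfolding w_def E_def by (cases vs rule: path_edges.cases) auto
    have "prob (path_event vs) \<le> 1" by (rule prob_le_1)
    also have "1 \<le> m ^ length vs * w" using one_le_power[OF m(1)] \<open>w = 1\<close> by simp
    finally show ?thesis by (simp add: w_def)
  next
    case False
    have EI: "(\<Inter>e\<in>E. occ e) = path_event vs"
      using False path_edges_complete[OF vs] occ_sets[THEN sets.sets_into_space]
      unfolding path_event_def E_def by blast
    let ?cp = "cond_prob_given M (weight_algebra M W)"
    have "AE \<omega> in M. ?cp (\<Inter>e\<in>E. occ e) \<omega> = (\<Prod>e\<in>E. ?cp (occ e) \<omega>)"
      using edges_cond_indep path_edges_complete[OF vs] False
      by (auto simp: cond_indep_events_def E_def)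
    then have bound: "AE \<omega> in M. 0 \<le> ?cp (path_event vs) \<omega> \<and>
        ?cp (path_event vs) \<omega> \<le> w * (\<Prod>x\<in>set vs. max 1 (W x \<omega>) powr (2 * t))"
      using cond_prob_edge_bounds[OF assms(1-3)]
    proof eventually_elim
      case (elim \<omega>)
      have "?cp (path_event vs) \<omega> = path_weight (\<lambda>u v. ?cp (occ {u, v}) \<omega>) vs"
        using elim(1) unfolding EI unfolding E_def prod_path_edges[OF vs] .
      moreover have "0 \<le> path_weight (\<lambda>u v. ?cp (occ {u, v}) \<omega>) vs \<and>
          path_weight (\<lambda>u v. ?cp (occ {u, v}) \<omega>) vs \<le>
          path_weight (\<lambda>u v. (lam powr t * decay (alpha * t) (v - u)) * (Z u \<omega> * Z v \<omega>)) vs"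
        using elim(2) unfolding Z_def by (intro path_weight_mono[OF vs]) blast
      moreover have "path_weight (\<lambda>u v. (lam powr t * decay (alpha * t) (v - u)) * (Z u \<omega> * Z v \<omega>)) vs
          = w * path_weight (\<lambda>u v. Z u \<omega> * Z v \<omega>) vs"
        unfolding w_def by (rule path_weight_times)
      moreover have "path_weight (\<lambda>u v. Z u \<omega> * Z v \<omega>) vs \<le> (\<Prod>x\<in>set vs. Z x \<omega> ^ 2)"
        using assms by (intro path_weight_vertices_le[OF vs]) (auto simp: Z_def intro: ge_one_powr_ge_zero)
      then have "w * path_weight (\<lambda>u v. Z u \<omega> * Z v \<omega>) vs \<le> w * (\<Prod>x\<in>set vs. Z x \<omega> ^ 2)"
        using w0 by (rule mult_left_mono)
      moreover have "(\<Prod>x\<in>set vs. Z x \<omega> ^ 2) = (\<Prod>x\<in>set vs. max 1 (W x \<omega>) powr (2 * t))"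
        by (intro prod.cong refl) (simp add: Z_def power2_eq_square powr_add[symmetric])
      ultimately show ?case by simp
    qed
    have "ennreal (prob (path_event vs)) = (\<integral>\<^sup>+\<omega>. ennreal (?cp (path_event vs) \<omega>) \<partial>M)"
      using bound path_event_sets[OF vs]
      by (subst nn_integral_eq_integral) (auto simp: integral_cond_prob integrable_cond_prob)
    also have "\<dots> \<le> (\<integral>\<^sup>+\<omega>. ennreal w * (\<Prod>x\<in>set vs. ennreal (max 1 (W x \<omega>) powr (2 * t))) \<partial>M)"
      using bound by (intro nn_integral_mono_AE)
        (auto elim!: eventually_mono simp: prod_ennreal ennreal_mult'[symmetric] w0 prod_nonneg intro!: ennreal_leI)
    also have "\<dots> = ennreal w * (\<integral>\<^sup>+\<omega>. (\<Prod>x\<in>set vs. ennreal (max 1 (W x \<omega>) powr (2 * t))) \<partial>M)"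
      by (intro nn_integral_cmult) measurable
    also have "(\<integral>\<^sup>+\<omega>. (\<Prod>x\<in>set vs. ennreal (max 1 (W x \<omega>) powr (2 * t))) \<partial>M)
        = (\<Prod>x\<in>set vs. \<integral>\<^sup>+\<omega>. ennreal (max 1 (W x \<omega>) powr (2 * t)) \<partial>M)"
    proof (rule indep_vars_nn_integral)
      have "indep_vars (\<lambda>_. borel) W (set vs)" by (rule indep_vars_subset[OF weights_indep]) simp
      then show "indep_vars (\<lambda>_. borel) (\<lambda>x \<omega>. ennreal (max 1 (W x \<omega>) powr (2 * t))) (set vs)"
        by (rule indep_vars_compose2) measurable
    qed auto
    also have "\<dots> \<le> (\<Prod>x\<in>set vs. ennreal m)"
      by (intro prod_mono_ennreal m)
    also have "\<dots> = ennreal (m ^ length vs)"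
      using m(1) vs by (simp add: ennreal_power distinct_card)
    finally have "ennreal (prob (path_event vs)) \<le> ennreal (w * m ^ length vs)"
      using w0 m(1) by (simp add: ennreal_mult' mult_left_mono)
    then show ?thesis using w0 m(1) by (simp add: w_def mult.commute)
  qed
qed

definition simple_paths :: "nat \<Rightarrow> int ^ 'd \<Rightarrow> (int ^ 'd) list set" where
  "simple_paths n x = {vs. distinct vs \<and> length vs = Suc n \<and> hd vs = 0 \<and> last vs = x}"

definition reach :: "nat \<Rightarrow> int ^ 'd \<Rightarrow> 'a set" where
  "reach n x = (\<Union>vs\<in>simple_paths n x. path_event vs)"

lemma reach_sets: "reach n x \<in> sets M"
  unfolding reach_def by (intro sets.countable_UN') (auto simp: simple_paths_def path_event_sets)

text \<open>The bound is uniform in the vertex because the weights share a law.\<close>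

lemma moment_bound:
  assumes "0 \<le> q" "q < s" "0 \<le> c" and tail: "\<And>w. 0 < w \<Longrightarrow> measure \<mu> {w<..} \<le> c * w powr (- s)"
  obtains m where "1 \<le> m" "\<And>x. (\<integral>\<^sup>+\<omega>. ennreal (max 1 (W x \<omega>) powr q) \<partial>M) \<le> ennreal m"
proof -
  define m where "m = 1 + 2 powr q * c / (1 - 2 powr (q - s))"
  have "2 powr (q - s) < 1" using assms by (simp add: powr_less_one)
  then have "1 \<le> m" using assms by (simp add: m_def)
  moreover have "(\<integral>\<^sup>+\<omega>. ennreal (max 1 (W x \<omega>) powr q) \<partial>M) \<le> ennreal m" for x
    unfolding m_def
  proof (rule nn_integral_powr_le_of_tail)
    fix w :: real assume "0 < w"
    have "measure \<mu> {w<..} = prob {\<omega> \<in> space M. w < W x \<omega>}"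
      unfolding weights_law[of x, symmetric]
      by (subst measure_distr) (auto simp: vimage_def Int_def conj_commute)
    then show "prob {\<omega> \<in> space M. w < W x \<omega>} \<le> c * w powr (- s)"
      using tail[OF \<open>0 < w\<close>] by simp
  qed (use assms in auto)
  ultimately show ?thesis using that by blast
qed

text \<open>The first moment bound for paths of a given length: the kernel \<open>lam powr t * decay\<close>, with the
  decay itself as majorant, satisfies the hypotheses of \<open>sum_path_weight_le\<close>.\<close>

lemma prob_reach_le:
  assumes "0 < lam" "0 < t" "t \<le> 1" "alpha * t > real CARD('d)"
    and m: "1 \<le> m" "\<And>x. (\<integral>\<^sup>+\<omega>. ennreal (max 1 (W x \<omega>) powr (2 * t)) \<partial>M) \<le> ennreal m"
  obtains A where "2 \<le> A" "\<And>n x. prob (reach n x) \<le> A ^ Suc n * decay (alpha * t) x"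
proof -
  define \<beta> where "\<beta> = alpha * t"
  obtain K where K: "0 \<le> K"
    "\<And>Z (x :: int ^ 'd) y. finite Z \<Longrightarrow> (\<Sum>z\<in>Z. decay \<beta> (z - x) * decay \<beta> (y - z)) \<le> K * decay \<beta> (y - x)"
    using decay_convolution[of \<beta>, where 'd = 'd] assms(4) unfolding \<beta>_def by blast
  define L where "L = lam powr t * K"
  have L: "0 \<le> L" using K by (simp add: L_def)
  define A where "A = max 2 (m * max 1 L)"
  have A: "2 \<le> A" "m * max 1 L \<le> A" by (auto simp: A_def)
  have "prob (reach n x) \<le> A ^ Suc n * decay \<beta> x" for n and x :: "int ^ 'd"
  proof -
    have "prob (reach n x) \<le> m ^ Suc n * (L ^ n * decay \<beta> (x - 0))"
      unfolding reach_def
    proof (rule measure_UN_le_of_finite_sums)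
      fix J assume J: "finite J" "J \<subseteq> simple_paths n x"
      have "(\<Sum>vs\<in>J. prob (path_event vs))
          \<le> (\<Sum>vs\<in>J. m ^ Suc n * path_weight (\<lambda>u v. lam powr t * decay \<beta> (v - u)) vs)"
      proof (rule sum_mono)
        fix vs assume "vs \<in> J"
        then have "distinct vs" "length vs = Suc n" using J by (auto simp: simple_paths_def)
        then show "prob (path_event vs) \<le> m ^ Suc n * path_weight (\<lambda>u v. lam powr t * decay \<beta> (v - u)) vs"
          using prob_path_event_le[OF assms(1-3) _ m, of vs] by (simp add: \<beta>_def)
      qed
      also have "\<dots> = m ^ Suc n * (\<Sum>vs\<in>J. path_weight (\<lambda>u v. lam powr t * decay \<beta> (v - u)) vs)"
        by (simp add: sum_distrib_left)
      also have "\<dots> \<le> m ^ Suc n * (L ^ n * decay \<beta> (x - 0))"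
      proof (intro mult_left_mono sum_path_weight_le[where h = "\<lambda>u v. decay \<beta> (v - u)"])
        fix Z :: "(int ^ 'd) set" and u v :: "int ^ 'd" assume "finite Z"
        then have "lam powr t * (\<Sum>z\<in>Z. decay \<beta> (z - u) * decay \<beta> (v - z)) \<le> lam powr t * (K * decay \<beta> (v - u))"
          by (intro mult_left_mono K) auto
        then show "(\<Sum>z\<in>Z. lam powr t * decay \<beta> (z - u) * decay \<beta> (v - z)) \<le> L * decay \<beta> (v - u)"
          by (simp add: L_def sum_distrib_left ac_simps)
      qed (use J m(1) in \<open>auto simp: decay_nonneg simple_paths_def\<close>)
      finally show "(\<Sum>vs\<in>J. prob (path_event vs)) \<le> m ^ Suc n * (L ^ n * decay \<beta> (x - 0))" .
    qed (auto simp: simple_paths_def path_event_sets)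
    also have "\<dots> = (m ^ Suc n * L ^ n) * decay \<beta> x" by simp
    also have "\<dots> \<le> A ^ Suc n * decay \<beta> x"
    proof (intro mult_right_mono decay_nonneg)
      have "m ^ Suc n * L ^ n \<le> m ^ Suc n * max 1 L ^ Suc n"
      proof (intro mult_left_mono)
        have "L ^ n \<le> max 1 L ^ n" using L by (intro power_mono) auto
        also have "\<dots> \<le> max 1 L ^ Suc n" by (intro power_increasing) auto
        finally show "L ^ n \<le> max 1 L ^ Suc n" .
      qed (use m in auto)
      also have "\<dots> = (m * max 1 L) ^ Suc n" by (simp only: power_mult_distrib)
      also have "\<dots> \<le> A ^ Suc n" using A m by (intro power_mono) auto
      finally show "m ^ Suc n * L ^ n \<le> A ^ Suc n" .
    qed
    finally show ?thesis .
  qed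
  then show ?thesis using that[of A] A(1) unfolding \<beta>_def by blast
qed

lemma dist_event_eq:
  "{\<omega> \<in> space M. ereal r \<le> ereal_of_enat (graph_dist (occupied_edges occ \<omega>) 0 x)} =
   space M - (\<Union>n<nat \<lceil>r\<rceil>. reach n x)"
proof -
  have paths: "graph_paths (occupied_edges occ \<omega>) 0 x = {vs. \<exists>n. vs \<in> simple_paths n x \<and> \<omega> \<in> path_event vs}"
    if "\<omega> \<in> space M" for \<omega>
  proof (intro set_eqI)
    fix vs :: "(int ^ 'd) list"
    have "distinct vs \<Longrightarrow> path_edges vs \<subseteq> occupied_edges occ \<omega> \<longleftrightarrow> \<omega> \<in> path_event vs"
      using path_edges_complete[of vs] that by (auto simp: occupied_edges_def path_event_def)
    moreover have "vs \<noteq> [] \<longleftrightarrow> (\<exists>n. length vs = Suc n)" by (cases vs) auto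
    ultimately show "vs \<in> graph_paths (occupied_edges occ \<omega>) 0 x \<longleftrightarrow>
        vs \<in> {vs. \<exists>n. vs \<in> simple_paths n x \<and> \<omega> \<in> path_event vs}"
      unfolding graph_paths_def simple_paths_def successively_iff_path_edges by auto
  qed
  have "ereal r \<le> ereal_of_enat (graph_dist (occupied_edges occ \<omega>) 0 x) \<longleftrightarrow>
      \<omega> \<notin> (\<Union>n<nat \<lceil>r\<rceil>. reach n x)" if "\<omega> \<in> space M" for \<omega>
  proof -
    have "ereal r \<le> ereal_of_enat (graph_dist (occupied_edges occ \<omega>) 0 x) \<longleftrightarrow>
        (\<forall>n. \<forall>vs\<in>simple_paths n x. \<omega> \<in> path_event vs \<longrightarrow> r \<le> real n)"
      unfolding le_graph_dist_iff paths[OF that] by (auto simp: simple_paths_def)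
    also have "\<dots> \<longleftrightarrow> (\<forall>n. \<omega> \<in> reach n x \<longrightarrow> \<not> n < nat \<lceil>r\<rceil>)"
      by (auto simp: reach_def not_less nat_le_iff ceiling_le_iff)
    finally show ?thesis by auto
  qed
  then show ?thesis by blast
qed

text \<open>A union bound over the path lengths below \<open>r\<close>; since \<open>A \<ge> 2\<close>, the geometric sum is dominated by the
  next power of \<open>A\<close>.\<close>

lemma prob_dist_ge:
  assumes A: "2 \<le> A" "\<And>n x. prob (reach n x) \<le> A ^ Suc n * D x" and "0 \<le> r" "0 \<le> D x"
  shows "1 - A powr (r + 2) * D x \<le>
    prob {\<omega> \<in> space M. ereal r \<le> ereal_of_enat (graph_dist (occupied_edges occ \<omega>) 0 x)}"
proof -
  define N where "N = nat \<lceil>r\<rceil>"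
  have geometric: "(\<Sum>n<k. A ^ Suc n) \<le> A ^ Suc k" for k
  proof (induction k)
    case (Suc k)
    have "(\<Sum>n<Suc k. A ^ Suc n) \<le> 2 * A ^ Suc k" using Suc by simp
    also have "\<dots> \<le> A * A ^ Suc k" using A(1) by (intro mult_right_mono) auto
    finally show ?case by simp
  qed (use A(1) in simp)
  have "prob (\<Union>n<N. reach n x) \<le> (\<Sum>n<N. prob (reach n x))"
    by (intro measure_UNION_le) (auto simp: reach_sets)
  also have "\<dots> \<le> (\<Sum>n<N. A ^ Suc n) * D x"
    unfolding sum_distrib_right by (intro sum_mono A(2))
  also have "\<dots> \<le> A ^ Suc N * D x"
    by (intro mult_right_mono geometric assms)
  also have "A ^ Suc N = A powr real (Suc N)"
    using A(1) by (subst powr_realpow) auto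
  also have "A powr real (Suc N) * D x \<le> A powr (r + 2) * D x"
  proof (intro mult_right_mono powr_mono assms)
    have "real N < r + 1" using \<open>0 \<le> r\<close> unfolding N_def by linarith
    then show "real (Suc N) \<le> r + 2" by simp
  qed (use A(1) in auto)
  finally show ?thesis
    unfolding dist_event_eq N_def[symmetric] using reach_sets by (subst prob_compl) auto
qed

end

section \<open>Logarithmic lower bound for the distance\<close>

theorem theorem5p4:
  fixes M :: "'a measure" and \<mu> :: "real measure"
    and W :: "int ^ 'd \<Rightarrow> 'a \<Rightarrow> real"
    and occ :: "(int ^ 'd) set \<Rightarrow> 'a set"
    and alpha lam tau c :: real
  assumes "scale_free_percolation M \<mu> W occ alpha lam"
    and "alpha > real CARD('d)"
    and "lam > 0"
    and "integrable \<mu> (\<lambda>w. w) \<longrightarrow> (\<integral>w. w \<partial>\<mu>) = 1"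
    and "tau > 1"
    and "c > 0"
    and "\<forall>w>0. measure \<mu> {w<..} \<le> c * w powr (- (tau - 1))"
    and "alpha * (tau - 1) / real CARD('d) > 2"
  shows "\<exists>\<eta>>0.
    ((\<lambda>x :: int ^ 'd. measure M {\<omega> \<in> space M.
        ereal (\<eta> * ln (euclid_norm x)) \<le> ereal_of_enat (graph_dist (occupied_edges occ \<omega>) 0 x)})
      \<longlongrightarrow> 1) (filtercomap euclid_norm at_top)"
proof -
  interpret scale_free_percolation M \<mu> W occ alpha lam by fact
  define dim where "dim = real CARD('d)"
  have dim: "0 < dim" by (simp add: dim_def)
  have alpha: "0 < alpha" using assms(2) dim by (simp add: dim_def)
  \<comment> \<open>The window for the interpolation exponent described at the beginning.\<close>
  have "dim / alpha < min 1 ((tau - 1) / 2)"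
    using assms(2,8) alpha dim by (simp add: dim_def field_simps)
  then obtain t where t: "dim / alpha < t" "t < min 1 ((tau - 1) / 2)"
    using dense by blast
  then have t': "0 < t" "t \<le> 1" "2 * t < tau - 1" "dim < alpha * t"
    using alpha dim by (auto simp: field_simps intro: less_trans[OF divide_pos_pos[OF dim alpha]])
  define \<beta> where "\<beta> = alpha * t"
  have \<beta>: "0 < \<beta>" using t' alpha by (simp add: \<beta>_def)
  obtain m where m: "1 \<le> m"
    "\<And>x. (\<integral>\<^sup>+\<omega>. ennreal (max 1 (W x \<omega>) powr (2 * t)) \<partial>M) \<le> ennreal m"
    using moment_bound[of "2 * t" "tau - 1" c] assms(6,7) t' by auto
  obtain A where A: "2 \<le> A" "\<And>n x. prob (reach n x) \<le> A ^ Suc n * decay \<beta> x"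
    using prob_reach_le[OF assms(3) t'(1,2) _ m] t'(4) unfolding \<beta>_def dim_def by blast
  \<comment> \<open>Half of the critical value: short paths then contribute at most a constant times
    \<open>norm x powr - (\<beta> / 2)\<close>.\<close>
  define \<eta> where "\<eta> = \<beta> / (2 * ln A)"
  have lnA: "0 < ln A" using A(1) by simp
  have \<eta>: "0 < \<eta>" using \<beta> lnA by (simp add: \<eta>_def)
  define P where "P x = prob {\<omega> \<in> space M.
    ereal (\<eta> * ln (euclid_norm x)) \<le> ereal_of_enat (graph_dist (occupied_edges occ \<omega>) 0 x)}"
    for x :: "int ^ 'd"
  have lower: "1 - A powr 2 * euclid_norm x powr (- (\<beta> / 2)) \<le> P x" if x: "1 \<le> euclid_norm x" for x :: "int ^ 'd"
  proof -
    have "x \<noteq> 0" using x by auto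
    have "A powr (\<eta> * ln (euclid_norm x)) = euclid_norm x powr (\<beta> / 2)"
      using x A(1) lnA by (simp add: powr_def \<eta>_def)
    then have "A powr (\<eta> * ln (euclid_norm x) + 2) * decay \<beta> x = A powr 2 * euclid_norm x powr (- (\<beta> / 2))"
      using \<open>x \<noteq> 0\<close> by (simp add: decay_nonzero powr_add powr_add[symmetric] mult.assoc mult.left_commute)
    then show ?thesis
      using prob_dist_ge[of A "decay \<beta>" "\<eta> * ln (euclid_norm x)" x] A \<eta> x
      by (simp add: P_def decay_nonneg)
  qed
  have "((\<lambda>r. 1 - A powr 2 * r powr (- (\<beta> / 2))) \<longlongrightarrow> 1 - A powr 2 * 0) at_top"
    using \<beta> by (intro tendsto_intros tendsto_neg_powr filterlim_ident) auto
  then have lim: "((\<lambda>x :: int ^ 'd. 1 - A powr 2 * euclid_norm x powr (- (\<beta> / 2))) \<longlongrightarrow> 1) (filtercomap euclid_norm at_top)"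
    by (intro filterlim_compose[OF _ filterlim_filtercomap]) simp
  have "(P \<longlongrightarrow> 1) (filtercomap euclid_norm at_top)"
  proof (rule tendsto_sandwich[OF _ _ lim tendsto_const])
    show "\<forall>\<^sub>F x in filtercomap euclid_norm at_top. 1 - A powr 2 * euclid_norm x powr (- (\<beta> / 2)) \<le> P x"
      unfolding eventually_filtercomap
      by (rule exI[of _ "\<lambda>r. 1 \<le> r"]) (simp add: eventually_ge_at_top lower)
    show "\<forall>\<^sub>F x in filtercomap euclid_norm at_top. P x \<le> 1"
      by (simp add: P_def)
  qed
  then show ?thesis using \<eta> unfolding P_def by blast
qed

end
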